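(* Let $\vartheta\colon\mathbb{N}\to\mathbb{N}$ be the function given by $\vartheta(n)=n+1$ if $n=2k+1$ is odd and $\vartheta(n)=n$ if $n=2k$ is even. Then $\gamma(S_n)\leq\vartheta(n)$.
   Context: For a group $G$, $V(G)$ denotes the set of all proper non-trivial subgroups of $G$. The intersection graph $\Gamma(G)$ is the simple undirected graph with vertex set $V(G)$ in which two distinct vertices $H,K$ are adjacent if and only if $H\cap K\neq 1$, where $1$ denotes the trivial subgroup. A dominating set of a graph is a subset $D$ of its vertex set such that every vertex not in $D$ is adjacent to some vertex in $D$. The domination number $\gamma(G)$ is the smallest cardinality of a dominating set of $\Gamma(G)$; by convention $\gamma(G)=\aleph_0$ when $V(G)$ is empty (that is, when $G$ is trivial or cyclic of prime order). $S_n$ is the group of all permutations of $\{1,\dots,n\}$.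
   Formalization: The bound is stated for n ≥ 3 only; for n ≤ 2 the group S_n is trivial or cyclic of order 2, so by the convention γ(S_n) = ℵ₀ and the inequality γ(S_n) ≤ ϑ(n) fails. *)

theory Defs
  imports
    "HOL-Algebra.Sym_Groups"
    "HOL-Library.Extended_Nat"
    "Graph_Theory.Pair_Digraph"
begin

definition proper_nontrivial_subgroups :: "('a, 'b) monoid_scheme \<Rightarrow> 'a set set" where
  "proper_nontrivial_subgroups G =
     {H. subgroup H G \<and> H \<noteq> carrier G \<and> H \<noteq> {\<one>\<^bsub>G\<^esub>}}"

text \<open>A simple undirected graph is represented as a symmetric loop-free digraph without
  parallel arcs.\<close>

definition intersection_graph :: "('a, 'b) monoid_scheme \<Rightarrow> 'a set pair_pre_digraph" where
  "intersection_graph G =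
     \<lparr> pverts = proper_nontrivial_subgroups G,
       parcs = {(H, K). H \<in> proper_nontrivial_subgroups G \<and> K \<in> proper_nontrivial_subgroups G
                  \<and> H \<noteq> K \<and> H \<inter> K \<noteq> {\<one>\<^bsub>G\<^esub>}} \<rparr>"

lemma intersection_graph_sym: "sym (parcs (intersection_graph G))"
  by (auto simp: intersection_graph_def sym_def)

lemma intersection_graph_loopfree: "(H, H) \<notin> parcs (intersection_graph G)"
  by (simp add: intersection_graph_def)

definition dominating_set :: "'v pair_pre_digraph \<Rightarrow> 'v set \<Rightarrow> bool" where
  "dominating_set \<Gamma> D \<longleftrightarrow>
     D \<subseteq> pverts \<Gamma> \<and> (\<forall>v \<in> pverts \<Gamma> - D. \<exists>u \<in> D. (v, u) \<in> parcs \<Gamma>)"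

definition set_size :: "'v set \<Rightarrow> enat" where
  "set_size D = (if finite D then enat (card D) else \<infinity>)"

text \<open>Every infinite cardinality is rendered as \<open>\<infinity>\<close>. The value \<open>\<infinity>\<close> for an empty vertex set is
  the convention \<open>\<gamma>(G) = \<aleph>\<^sub>0\<close>; without the case distinction the infimum would be 0 there,
  as the empty set dominates the empty graph.\<close>

definition domination_number :: "('a, 'b) monoid_scheme \<Rightarrow> enat" where
  "domination_number G =
     (if proper_nontrivial_subgroups G = {} then \<infinity>
      else INF D \<in> {D. dominating_set (intersection_graph G) D}. set_size D)"

definition vartheta :: "nat \<Rightarrow> nat" where
  "vartheta n = (if odd n then n + 1 else n)"

end

theory Submission
  imports Defs "HOL-Library.Disjoint_Sets" "HOL-Library.Z2"
begin

text \<open>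
  In a subgroup that meets the alternating group trivially, every element squares to the
  identity, because the square of any permutation is even. It is therefore enough to take the
  alternating group together with a family of proper non-trivial subgroups whose union contains
  every involution of \<open>{1..n}\<close>. The setwise stabilizers of the sets
  \<open>{1, i}\<close> are such a family: an involution \<open>g\<close> exchanges \<open>1\<close> and \<open>g 1\<close>, hence lies in the
  stabilizer of \<open>{1, g 1}\<close>. With \<open>i\<close> running over \<open>{1..n}\<close> this gives \<open>n + 1\<close> subgroups.

  For even \<open>n\<close> the point stabilizer (\<open>i = 1\<close>) can be dropped. An involution moves an even number
  of points, so if it fixes \<open>1\<close>, it also fixes some \<open>i \<noteq> 1\<close> (lemma
  \<open>involution_other_fixed_point\<close>) and thus stabilizes \<open>{1, i}\<close>. That leaves \<open>n\<close> subgroups.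
\<close>

text \<open>
  Over the field with two elements, the contributions of \<open>x\<close> and \<open>f x\<close> to the sum \<open>\<Sum>x\<in>A. 1\<close>
  cancel, so that the cardinality of \<open>A\<close> is zero modulo 2.
\<close>

lemma even_card_fixed_point_free_involution:
  assumes "\<And>x. x \<in> A \<Longrightarrow> f x \<in> A"
    and "\<And>x. x \<in> A \<Longrightarrow> f (f x) = x" and "\<And>x. x \<in> A \<Longrightarrow> f x \<noteq> x"
  shows "even (card A)"
proof -
  have "(\<Sum>x\<in>A. 1 :: bit) = 0"
    using assms by (intro sum_involution_eq_0[where h = f]) auto
  then have "of_nat (card A) = (0 :: bit)"
    by simp
  then have "even (of_nat (card A) :: bit)"
    by simp
  then show ?thesis
    by (simp only: even_of_nat_iff)
qed

text \<open>
  Without a second fixed point, \<open>g\<close> would restrict to a fixed-point-free involution of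
  \<open>A - {a}\<close>, a set of odd size.
\<close>

lemma involution_other_fixed_point:
  assumes "finite A" and "even (card A)" and "a \<in> A" and "g permutes A"
    and "g \<circ> g = id" and "g a = a"
  shows "\<exists>b \<in> A. b \<noteq> a \<and> g b = b"
proof (rule ccontr)
  assume no_other: "\<not> ?thesis"
  have "even (card (A - {a}))"
  proof (rule even_card_fixed_point_free_involution[where f = g])
    show "g x \<in> A - {a}" if "x \<in> A - {a}" for x
      using that permutes_in_image[OF assms(4), of x] inj_eq[OF permutes_inj[OF assms(4)], of x a]
        assms(6) by auto
    show "g (g x) = x" for x
      using fun_cong[OF assms(5), of x] by simp
  qed (use no_other in auto)
  moreover have "card A = Suc (card (A - {a}))"
    using card.remove[OF assms(1,3)] .
  ultimately show False
    using assms(2) by simp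
qed

definition setwise_stabilizer :: "nat \<Rightarrow> nat set \<Rightarrow> (nat \<Rightarrow> nat) set" where
  "setwise_stabilizer n S = {p. p permutes {1..n} \<and> p ` S = S}"

lemma setwise_stabilizer_subgroup:
  "subgroup (setwise_stabilizer n S) (sym_group n)"
proof (rule group.subgroupI[OF sym_group_is_group])
  show "setwise_stabilizer n S \<subseteq> carrier (sym_group n)"
    by (auto simp: setwise_stabilizer_def sym_group_carrier)
  show "setwise_stabilizer n S \<noteq> {}"
    using permutes_id[of "{1..n}"] by (auto simp: setwise_stabilizer_def intro: exI[of _ id])
next
  fix p assume "p \<in> setwise_stabilizer n S"
  then have p: "p permutes {1..n}" and img: "p ` S = S"
    by (auto simp: setwise_stabilizer_def)
  have "inv' p ` S = S"
    using image_inv_f_f[OF permutes_inj[OF p], of S] img by simp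
  then show "inv\<^bsub>sym_group n\<^esub> p \<in> setwise_stabilizer n S"
    using p by (simp add: setwise_stabilizer_def sym_group_carrier permutes_inv)
next
  fix p q assume "p \<in> setwise_stabilizer n S" "q \<in> setwise_stabilizer n S"
  moreover have "(p \<circ> q) ` S = p ` q ` S"
    by (rule image_comp[symmetric])
  ultimately show "p \<otimes>\<^bsub>sym_group n\<^esub> q \<in> setwise_stabilizer n S"
    by (simp add: setwise_stabilizer_def sym_group_mult permutes_compose del: image_comp)
qed

text \<open>
  For \<open>i \<noteq> 1\<close> the transposition of \<open>1\<close> and \<open>i\<close> is a non-trivial element; for \<open>i = 1\<close> it is the
  transposition of \<open>2\<close> and \<open>3\<close>. Exchanging \<open>1\<close> with a point outside \<open>{1, i}\<close> gives a permutation
  that is not in the stabilizer.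
\<close>

lemma pair_stabilizer_proper_nontrivial:
  assumes "n \<ge> 3" and "i \<in> {1..n}"
  shows "setwise_stabilizer n {1, i} \<in> proper_nontrivial_subgroups (sym_group n)"
proof -
  define t where "t = (if i = 1 then transpose 2 3 else transpose 1 i :: nat \<Rightarrow> nat)"
  have t: "t \<in> setwise_stabilizer n {1, i}"
    using assms by (auto simp: t_def setwise_stabilizer_def transpose_def intro!: permutes_swap_id)
  have "t \<noteq> id"
  proof
    assume "t = id"
    then have "t 1 = 1" "t 2 = 2"
      by auto
    then show False
      by (auto simp: t_def transpose_def split: if_splits)
  qed
  then have nontrivial: "setwise_stabilizer n {1, i} \<noteq> {\<one>\<^bsub>sym_group n\<^esub>}"
    using t by (auto simp: sym_group_one)
  define k where "k = (if i = 2 then 3 else 2 :: nat)"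
  have "transpose 1 k permutes {1..n}"
    using assms by (intro permutes_swap_id) (auto simp: k_def)
  moreover have "transpose 1 k ` {1, i} \<noteq> {1, i}"
  proof -
    have "k \<noteq> 1" "k \<noteq> i" "k \<in> transpose 1 k ` {1, i}"
      by (auto simp: k_def)
    then show ?thesis
      by auto
  qed
  ultimately have "setwise_stabilizer n {1, i} \<noteq> carrier (sym_group n)"
    by (metis (mono_tags, lifting) mem_Collect_eq setwise_stabilizer_def sym_group_carrier)
  then show ?thesis
    using nontrivial setwise_stabilizer_subgroup by (simp add: proper_nontrivial_subgroups_def)
qed

lemma alt_group_proper_nontrivial:
  assumes "n \<ge> 3"
  shows "carrier (alt_group n) \<in> proper_nontrivial_subgroups (sym_group n)"
proof -
  have double: "2 * card (carrier (alt_group n)) = fact n"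
    using alt_group_card_carrier assms by simp
  have "fact n \<ge> (fact 3 :: nat)"
    using assms by (rule fact_mono_nat)
  then have "card (carrier (alt_group n)) \<ge> 3"
    using double by (simp add: fact_numeral)
  moreover have "card (carrier (alt_group n)) \<noteq> card (carrier (sym_group n))"
    using double fact_nonzero[of n, where ?'a = nat] unfolding sym_group_card_carrier by linarith
  ultimately show ?thesis
    using alt_group_is_subgroup by (auto simp: proper_nontrivial_subgroups_def)
qed

text \<open>
  The square of a permutation is even, so \<open>g \<circ> g\<close> lies in the intersection.
\<close>

lemma involution_if_trivial_meet_alt_group:
  assumes H: "subgroup H (sym_group n)"
    and meet: "H \<inter> carrier (alt_group n) = {\<one>\<^bsub>sym_group n\<^esub>}" and g: "g \<in> H"
  shows "g \<circ> g = id"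
proof -
  have g_perm: "g permutes {1..n}"
    using subgroup.mem_carrier[OF H g] by (simp add: sym_group_carrier)
  have "g \<circ> g \<in> H"
    using subgroup.m_closed[OF H g g] by (simp add: sym_group_mult)
  moreover have "g \<circ> g \<in> carrier (alt_group n)"
    using g_perm permutes_imp_permutation[OF _ g_perm]
    by (simp add: alt_group_carrier evenperm_comp permutes_compose)
  ultimately show ?thesis
    using meet by (auto simp: sym_group_one)
qed

theorem theorem5p2:
  fixes n :: nat
  assumes "n \<ge> 3"
  shows "domination_number (sym_group n) \<le> enat (vartheta n)"
proof -
  let ?V = "proper_nontrivial_subgroups (sym_group n)"
  define I where "I = (if odd n then {1..n} else {2..n})"
  define D where
    "D = insert (carrier (alt_group n)) ((\<lambda>i. setwise_stabilizer n {1, i}) ` I)"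
  have I: "finite I" "I \<subseteq> {1..n}" "Suc (card I) = vartheta n"
    using assms by (auto simp: I_def vartheta_def)
  have D_sub: "D \<subseteq> ?V"
    using I(2) alt_group_proper_nontrivial[OF assms]
      pair_stabilizer_proper_nontrivial[OF assms] by (auto simp: D_def)
  have meets_D: "\<exists>K \<in> D. H \<inter> K \<noteq> {\<one>\<^bsub>sym_group n\<^esub>}" if "H \<in> ?V" for H
  proof (cases "H \<inter> carrier (alt_group n) = {\<one>\<^bsub>sym_group n\<^esub>}")
    case False
    then show ?thesis
      by (auto simp: D_def)
  next
    case True
    have H: "subgroup H (sym_group n)" and "H \<noteq> {id}"
      using that by (auto simp: proper_nontrivial_subgroups_def sym_group_one)
    then obtain g where g: "g \<in> H" "g \<noteq> id"
      using subgroup.one_closed[OF H] by (auto simp: sym_group_one)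
    have g_perm: "g permutes {1..n}"
      using subgroup.mem_carrier[OF H g(1)] by (simp add: sym_group_carrier)
    have g_inv: "g \<circ> g = id"
      using involution_if_trivial_meet_alt_group[OF H True g(1)] .
    \<comment> \<open>The natural choice is \<open>i = g 1\<close>; it lies outside \<open>I\<close> only if \<open>n\<close> is even and \<open>g\<close> fixes \<open>1\<close>.\<close>
    have "\<exists>i \<in> I. g ` {1, i} = {1, i}"
    proof (cases "g 1 = 1 \<and> even n")
      case True
      then obtain b where "b \<in> {1..n}" "b \<noteq> 1" "g b = b"
        using involution_other_fixed_point[OF _ _ _ g_perm g_inv, of 1] assms by auto
      then show ?thesis
        using True by (intro bexI[of _ b]) (auto simp: I_def)
    next
      case False
      have "g 1 \<in> {1..n}"
        using permutes_in_image[OF g_perm, of 1] assms by simp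
      then have "g 1 \<in> I"
        using False by (auto simp: I_def)
      moreover have "g (g 1) = 1"
        using fun_cong[OF g_inv, of 1] by simp
      ultimately show ?thesis
        by (intro bexI[of _ "g 1"]) auto
    qed
    then obtain i where "i \<in> I" "g \<in> setwise_stabilizer n {1, i}"
      using g_perm by (auto simp: setwise_stabilizer_def)
    then show ?thesis
      using g by (auto simp: D_def sym_group_one)
  qed
  then have "dominating_set (intersection_graph (sym_group n)) D"
    using D_sub by (fastforce simp: dominating_set_def intersection_graph_def)
  then have "domination_number (sym_group n) \<le> set_size D"
    using alt_group_proper_nontrivial[OF assms]
    by (auto simp: domination_number_def intro: INF_lower)
  also have "set_size D \<le> enat (vartheta n)"
  proof -
    have "card D \<le> Suc (card ((\<lambda>i. setwise_stabilizer n {1, i}) ` I))"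
      using I(1) by (simp add: D_def card_insert_if)
    also have "\<dots> \<le> Suc (card I)"
      using card_image_le[OF I(1)] by simp
    finally have "card D \<le> Suc (card I)" .
    then show ?thesis
      using I by (simp add: set_size_def D_def)
  qed
  finally show ?thesis .
qed

end
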